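(* Let $\Lambda_{BD}$ be the $2$-graph associated to basic data $BD=(T,A,\{f_p:p\in A^P\})$. Suppose $k\in\mathbb N$ satisfies $(k-1)(e_1+e_2)\in T$ and $k(e_1+e_2)\notin T$. Then for every $u,v\in\Lambda_{BD}^0$ there exists $\lambda\in\Lambda_{BD}^{k(e_1+e_2)}$ such that $r(\lambda)=v$ and $s(\lambda)=u$. Hence $\Lambda_{BD}$ is strongly connected.
   Context: $\mathbb N=\{0,1,2,\dots\}$; $\mathbb N^2$ is a semigroup under addition with basis $e_1,e_2$ and the coordinatewise partial order $\le$. A tile $T$ is a nonempty finite subset of $\mathbb N^2$ that is hereditary ($n\in T$ and $0\le m\le n$ imply $m\in T$); $(c_1,c_2)$ denotes the coordinatewise maximum of the elements of $T$; $T$ is nondegenerate if $|T|\ge 2$. For nondegenerate $T$ put $P=T\setminus\{c_1e_1,c_2e_2\}$. Basic data is a triple $BD=(T,A,\{f_p:p\in A^P\})$ where $T$ is a nondegenerate tile, $A$ is a finite nonempty set, and for each function $p\in A^P$ (with $A^\emptyset=\{\emptyset\}$), $f_p:A\to A$ is a bijection. For $p\in A^P$, $a\in A$ define $F_{p,a}:T\to A$ by $F_{p,a}(c_2e_2)=a$, $F_{p,a}(c_1e_1)=f_p(a)$, $F_{p,a}(t)=p(t)$ for $t\in P$, and let $\Lambda_{BD}^0=\{F_{p,a}:p\in A^P,a\in A\}$. For $S\subset\mathbb N^2$, $n\in\mathbb N^2$ let $S+n=\{m+n:m\in S\}$, and $T(n)=\bigcup_{0\le m\le n}(T+m)$. If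 $f:S\to A$ with $T+n\subset S$, define $f\downarrow_{T+n}:T\to A$ by $f\downarrow_{T+n}(i)=f(i+n)$. A path of degree $n\in\mathbb N^2$ is a function $\lambda:T(n)\to A$ with $\lambda\downarrow_{T+m}\in\Lambda_{BD}^0$ for all $0\le m\le n$; its range is $r(\lambda)=\lambda\downarrow_T$ and its source is $s(\lambda)=\lambda\downarrow_{T+n}$. $\Lambda_{BD}^n$ is the set of paths of degree $n$. For $\lambda\in\Lambda_{BD}^\ell$ and $0\le m\le n\le\ell$, $\lambda(m,n)$ is the path of degree $n-m$ given by $\lambda(m,n)(i)=\lambda(m+i)$ for $i\in T(n-m)$. The $2$-graph $\Lambda_{BD}$ is the category with objects $\Lambda_{BD}^0$, morphisms all paths, and composite $\mu\nu$ (for $s(\mu)=r(\nu)$) the unique path $\lambda$ of degree $d(\mu)+d(\nu)$ with $\lambda(0,d(\mu))=\mu$, $\lambda(d(\mu),d(\mu)+d(\nu))=\nu$, where $d$ denotes degree. A $k$-graph $\Lambda$ is strongly connected if for all $u,v\in\Lambda^0$ there exists $\lambda\in\Lambda$ with $r(\lambda)=v$ and $s(\lambda)=u$. *)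

theory Defs
  imports "HOL-Library.Product_Order" "HOL-Library.FuncSet"
begin

(* The semigroup N^2 is nat * nat, with the componentwise addition and the componentwise
   order of Product_Plus and Product_Order.  A function S -> B is an element of the extensional
   function space S \<rightarrow>\<^sub>E B, so that equality of functions is equality on S. *)

definition tile :: "(nat \<times> nat) set \<Rightarrow> bool" where
  "tile T \<longleftrightarrow> finite T \<and> T \<noteq> {} \<and> (\<forall>n\<in>T. \<forall>m. 0 \<le> m \<and> m \<le> n \<longrightarrow> m \<in> T)"

definition nondegenerate_tile :: "(nat \<times> nat) set \<Rightarrow> bool" where
  "nondegenerate_tile T \<longleftrightarrow> tile T \<and> card T \<ge> 2"

(* (c_1, c_2) is the coordinatewise maximum of T; the two definitions below are
   the corner points c_1 e_1 and c_2 e_2. *)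

definition corner1 :: "(nat \<times> nat) set \<Rightarrow> nat \<times> nat" where
  "corner1 T = (Max (fst ` T), 0)"

definition corner2 :: "(nat \<times> nat) set \<Rightarrow> nat \<times> nat" where
  "corner2 T = (0, Max (snd ` T))"

definition tile_P :: "(nat \<times> nat) set \<Rightarrow> (nat \<times> nat) set" where
  "tile_P T = T - {corner1 T, corner2 T}"

definition basic_data ::
  "(nat \<times> nat) set \<Rightarrow> 'a set \<Rightarrow> ((nat \<times> nat \<Rightarrow> 'a) \<Rightarrow> 'a \<Rightarrow> 'a) \<Rightarrow> bool" where
  "basic_data T A f \<longleftrightarrow>
     nondegenerate_tile T \<and> finite A \<and> A \<noteq> {} \<and>
     (\<forall>p \<in> tile_P T \<rightarrow>\<^sub>E A. bij_betw (f p) A A)"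

definition vertex_fun ::
  "(nat \<times> nat) set \<Rightarrow> ((nat \<times> nat \<Rightarrow> 'a) \<Rightarrow> 'a \<Rightarrow> 'a) \<Rightarrow> (nat \<times> nat \<Rightarrow> 'a) \<Rightarrow> 'a \<Rightarrow> nat \<times> nat \<Rightarrow> 'a" where
  "vertex_fun T f p a =
     (\<lambda>t\<in>T. if t = corner2 T then a else if t = corner1 T then f p a else p t)"

definition vertices ::
  "(nat \<times> nat) set \<Rightarrow> 'a set \<Rightarrow> ((nat \<times> nat \<Rightarrow> 'a) \<Rightarrow> 'a \<Rightarrow> 'a) \<Rightarrow> (nat \<times> nat \<Rightarrow> 'a) set" where
  "vertices T A f = {vertex_fun T f p a | p a. p \<in> tile_P T \<rightarrow>\<^sub>E A \<and> a \<in> A}"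

definition translates :: "(nat \<times> nat) set \<Rightarrow> nat \<times> nat \<Rightarrow> (nat \<times> nat) set" where
  "translates T n = (\<Union>m\<in>{0..n}. (\<lambda>i. i + m) ` T)"

(* g restricted to T + n and translated back to T *)
definition down :: "(nat \<times> nat) set \<Rightarrow> (nat \<times> nat \<Rightarrow> 'a) \<Rightarrow> nat \<times> nat \<Rightarrow> nat \<times> nat \<Rightarrow> 'a" where
  "down T g n = (\<lambda>i\<in>T. g (i + n))"

definition paths ::
  "(nat \<times> nat) set \<Rightarrow> 'a set \<Rightarrow> ((nat \<times> nat \<Rightarrow> 'a) \<Rightarrow> 'a \<Rightarrow> 'a) \<Rightarrow> nat \<times> nat \<Rightarrow> (nat \<times> nat \<Rightarrow> 'a) set" where
  "paths T A f n =
     {l \<in> translates T n \<rightarrow>\<^sub>E A. \<forall>m. 0 \<le> m \<and> m \<le> n \<longrightarrow> down T l m \<in> vertices T A f}"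

definition path_range :: "(nat \<times> nat) set \<Rightarrow> (nat \<times> nat \<Rightarrow> 'a) \<Rightarrow> nat \<times> nat \<Rightarrow> 'a" where
  "path_range T l = down T l 0"

definition path_source :: "(nat \<times> nat) set \<Rightarrow> nat \<times> nat \<Rightarrow> (nat \<times> nat \<Rightarrow> 'a) \<Rightarrow> nat \<times> nat \<Rightarrow> 'a" where
  "path_source T n l = down T l n"

(* the factor l(m,n), a path of degree n - m *)
definition segment ::
  "(nat \<times> nat) set \<Rightarrow> (nat \<times> nat \<Rightarrow> 'a) \<Rightarrow> nat \<times> nat \<Rightarrow> nat \<times> nat \<Rightarrow> nat \<times> nat \<Rightarrow> 'a" where
  "segment T l m n = (\<lambda>i\<in>translates T (n - m). l (m + i))"

(* the underlying data of a k-graph: a small category with a degree map *)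
record ('o, 'm, 'd) kgraph =
  objs :: "'o set"
  mors :: "'m set"
  deg :: "'m \<Rightarrow> 'd"
  rng :: "'m \<Rightarrow> 'o"
  src :: "'m \<Rightarrow> 'o"
  ident :: "'o \<Rightarrow> 'm"
  compose :: "'m \<Rightarrow> 'm \<Rightarrow> 'm"

definition strongly_connected :: "('o, 'm, 'd) kgraph \<Rightarrow> bool" where
  "strongly_connected G \<longleftrightarrow>
     (\<forall>u\<in>objs G. \<forall>v\<in>objs G. \<exists>l\<in>mors G. rng G l = v \<and> src G l = u)"

(* Extensional functions do not record their domain, hence a morphism is a pair (n, l) with l a path
   of degree n.  The composite is only meaningful for src mu = rng nu. *)
definition Lambda_BD ::
  "(nat \<times> nat) set \<Rightarrow> 'a set \<Rightarrow> ((nat \<times> nat \<Rightarrow> 'a) \<Rightarrow> 'a \<Rightarrow> 'a)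
   \<Rightarrow> (nat \<times> nat \<Rightarrow> 'a, (nat \<times> nat) \<times> (nat \<times> nat \<Rightarrow> 'a), nat \<times> nat) kgraph" where
  "Lambda_BD T A f =
     \<lparr> objs = vertices T A f,
       mors = {(n, l). l \<in> paths T A f n},
       deg = fst,
       rng = (\<lambda>(n, l). path_range T l),
       src = (\<lambda>(n, l). path_source T n l),
       ident = (\<lambda>v. (0, v)),
       compose = (\<lambda>(m, \<mu>) (n, \<nu>).
         (m + n, THE l. l \<in> paths T A f (m + n) \<and>
                        segment T l 0 m = \<mu> \<and> segment T l m (m + n) = \<nu>)) \<rparr>"

end

theory Submission
  imports Defs
begin

text \<open>
  A path of degree \<open>(k, k)\<close> is a labelling of \<open>T(k, k)\<close> subject to one constraint for each translate
  \<open>T + m\<close> with \<open>m \<le> (k, k)\<close>.  Since \<open>f\<^sub>p\<close> is a bijection, such a constraint can always be satisfied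
  by relabelling a single corner of \<open>T + m\<close>, and either of its two corners will do.

  Because \<open>(k, k) \<notin> T\<close>, the tiles \<open>T\<close> and \<open>T + (k, k)\<close> are disjoint, so they can be labelled by \<open>v\<close>
  and \<open>u\<close> independently.  This settles the constraints at \<open>0\<close> and \<open>(k, k)\<close>.  For any other
  \<open>m = (i, j)\<close> use the corner that points away from the diagonal: \<open>c\<^sub>1e\<^sub>1 + m\<close> if \<open>j \<le> i\<close>, and
  \<open>c\<^sub>2e\<^sub>2 + m\<close> if \<open>i < j\<close>.  These corners avoid \<open>T\<close> and \<open>T + (k, k)\<close> (lemma
  \<open>outer_corner_avoids_end_tiles\<close>).  Moreover, the corner chosen for \<open>m'\<close> lies in another tile
  \<open>T + m\<close> only if \<open>m'\<close> is strictly nearer to the diagonal than \<open>m\<close> (lemma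
  \<open>outer_corner_in_other_tile\<close>).  Hence the constraints can be satisfied one after another, moving away
  from the diagonal, and no step spoils an earlier one (lemma \<open>solve_ranked_constraints\<close>).
\<close>

section \<open>Systems of constraints solved in order of rank\<close>

text \<open>
  Constraint \<open>m\<close> only looks at labels on \<open>S m\<close> and can be repaired by relabelling \<open>d m\<close>.  The
  constraints are repaired in order of increasing rank, so that the point \<open>d m\<close> relabelled last
  lies in none of the sets \<open>S m'\<close> treated before.
\<close>

lemma solve_ranked_constraints:
  fixes M :: "'m set" and d :: "'m \<Rightarrow> 'x" and rank :: "'m \<Rightarrow> nat" and g0 :: "'x \<Rightarrow> 'a"
  assumes "finite M"
    and local: "\<And>m g h. \<lbrakk>\<And>x. x \<in> S m \<Longrightarrow> g x = h x; C m g\<rbrakk> \<Longrightarrow> C m h"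
    and solvable: "\<And>m g. \<lbrakk>m \<in> M; range g \<subseteq> A\<rbrakk> \<Longrightarrow> \<exists>a\<in>A. C m (g(d m := a))"
    and ranked: "\<And>m m'. \<lbrakk>m \<in> M; m' \<in> M; m \<noteq> m'; d m' \<in> S m\<rbrakk> \<Longrightarrow> rank m' < rank m"
    and "range g0 \<subseteq> A"
  obtains g where "range g \<subseteq> A" and "\<And>x. x \<notin> d ` M \<Longrightarrow> g x = g0 x" and "\<And>m. m \<in> M \<Longrightarrow> C m g"
proof -
  have "\<exists>g. range g \<subseteq> A \<and> (\<forall>x. x \<notin> d ` M \<longrightarrow> g x = g0 x) \<and> (\<forall>m\<in>M. C m g)"
    using \<open>finite M\<close> solvable ranked
  proof (induction M rule: finite_ranking_induct[where f = rank])
    case empty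
    then show ?case using \<open>range g0 \<subseteq> A\<close> by auto
  next
    case (insert m M)
    have "\<exists>g. range g \<subseteq> A \<and> (\<forall>x. x \<notin> d ` M \<longrightarrow> g x = g0 x) \<and> (\<forall>m\<in>M. C m g)"
      by (rule insert.IH) (use insert.prems in blast)+
    then obtain g where g: "range g \<subseteq> A" "\<And>x. x \<notin> d ` M \<Longrightarrow> g x = g0 x" "\<And>m. m \<in> M \<Longrightarrow> C m g"
      by blast
    show ?case
    proof (cases "m \<in> M")
      case True
      then show ?thesis using g by (auto simp: insert_absorb)
    next
      case False
      obtain a where a: "a \<in> A" "C m (g(d m := a))"
        using insert.prems(1)[of m g] g(1) by blast
      have "C m' (g(d m := a))" if "m' \<in> M" for m'
      proof (rule local[OF _ g(3)[OF that]])
        have "d m \<notin> S m'"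
          using insert.prems(2)[of m' m] insert.hyps(2)[OF that] that False by auto
        then show "g x = (g(d m := a)) x" if "x \<in> S m'" for x
          using that by auto
      qed
      then show ?thesis
        using a g(1,2) by (intro exI[of _ "g(d m := a)"]) (auto simp del: fun_upd_apply, auto)
    qed
  qed
  then show thesis using that by blast
qed

section \<open>Tiles and their vertices\<close>

lemma fst_le_corner1: "\<lbrakk>tile T; t \<in> T\<rbrakk> \<Longrightarrow> fst t \<le> fst (corner1 T)"
  by (simp add: tile_def corner1_def)

lemma snd_le_corner2: "\<lbrakk>tile T; t \<in> T\<rbrakk> \<Longrightarrow> snd t \<le> snd (corner2 T)"
  by (simp add: tile_def corner2_def)

lemma tile_downward: "\<lbrakk>tile T; n \<in> T; m \<le> n\<rbrakk> \<Longrightarrow> m \<in> T"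
  unfolding tile_def by (metis less_eq_prod_def fst_zero snd_zero zero_le)

lemma corner1_in_tile:
  assumes "tile T"
  shows "corner1 T \<in> T"
proof -
  have "Max (fst ` T) \<in> fst ` T"
    using assms by (intro Max_in) (auto simp: tile_def)
  then obtain t where "t \<in> T" "fst t = Max (fst ` T)" by auto
  then show ?thesis
    using tile_downward[OF assms, of t] by (simp add: corner1_def less_eq_prod_def)
qed

lemma corner2_in_tile:
  assumes "tile T"
  shows "corner2 T \<in> T"
proof -
  have "Max (snd ` T) \<in> snd ` T"
    using assms by (intro Max_in) (auto simp: tile_def)
  then obtain t where "t \<in> T" "snd t = Max (snd ` T)" by auto
  then show ?thesis
    using tile_downward[OF assms, of t] by (simp add: corner2_def less_eq_prod_def)
qed

text \<open>
  The corners can only coincide at the origin, and then the whole tile is \<open>{0}\<close>.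
\<close>

lemma corners_distinct:
  assumes "nondegenerate_tile T"
  shows "corner1 T \<noteq> corner2 T"
proof
  assume eq: "corner1 T = corner2 T"
  have "tile T" "card T \<ge> 2"
    using assms by (auto simp: nondegenerate_tile_def)
  have "T \<subseteq> {(0, 0)}"
  proof
    fix t assume "t \<in> T"
    from eq have "fst (corner1 T) = 0" "snd (corner2 T) = 0"
      by (auto simp: corner1_def corner2_def)
    then have "fst t = 0" "snd t = 0"
      using fst_le_corner1[OF \<open>tile T\<close> \<open>t \<in> T\<close>] snd_le_corner2[OF \<open>tile T\<close> \<open>t \<in> T\<close>] by simp_all
    then show "t \<in> {(0, 0)}" by (simp add: prod_eq_iff)
  qed
  then have "card T \<le> 1"
    using card_mono[of "{(0, 0)}" T] by simp
  with \<open>card T \<ge> 2\<close> show False by simp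
qed

lemma vertices_iff:
  assumes "basic_data T A f"
  shows "x \<in> vertices T A f \<longleftrightarrow>
    x \<in> T \<rightarrow>\<^sub>E A \<and> x (corner1 T) = f (restrict x (tile_P T)) (x (corner2 T))"
proof -
  have nd: "nondegenerate_tile T" and bij: "\<And>p. p \<in> tile_P T \<rightarrow>\<^sub>E A \<Longrightarrow> bij_betw (f p) A A"
    using assms by (auto simp: basic_data_def)
  then have tile: "tile T" by (simp add: nondegenerate_tile_def)
  note corners = corners_distinct[OF nd] corner1_in_tile[OF tile] corner2_in_tile[OF tile]
  show ?thesis
  proof
    assume "x \<in> vertices T A f"
    then obtain p a where p: "p \<in> tile_P T \<rightarrow>\<^sub>E A" and a: "a \<in> A" and x: "x = vertex_fun T f p a"
      by (auto simp: vertices_def)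
    have "f p a \<in> A"
      using bij_betwE[OF bij[OF p]] a by blast
    then have "x \<in> T \<rightarrow>\<^sub>E A"
      using p a by (auto simp: x vertex_fun_def tile_P_def PiE_iff)
    moreover have "restrict x (tile_P T) = p"
    proof
      fix t show "restrict x (tile_P T) t = p t"
        using PiE_arb[OF p, of t] by (auto simp: x vertex_fun_def tile_P_def)
    qed
    ultimately show "x \<in> T \<rightarrow>\<^sub>E A \<and> x (corner1 T) = f (restrict x (tile_P T)) (x (corner2 T))"
      using corners by (simp add: x vertex_fun_def)
  next
    assume x: "x \<in> T \<rightarrow>\<^sub>E A \<and> x (corner1 T) = f (restrict x (tile_P T)) (x (corner2 T))"
    let ?p = "restrict x (tile_P T)"
    have "x = vertex_fun T f ?p (x (corner2 T))"
    proof
      fix t show "x t = vertex_fun T f ?p (x (corner2 T)) t"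
        using x PiE_arb[of x T "\<lambda>_. A" t] corners by (auto simp: vertex_fun_def tile_P_def)
    qed
    moreover have "?p \<in> tile_P T \<rightarrow>\<^sub>E A" "x (corner2 T) \<in> A"
      using x corners by (auto simp: tile_P_def PiE_iff)
    ultimately show "x \<in> vertices T A f"
      unfolding vertices_def by blast
  qed
qed

lemma down_in_vertices_iff:
  assumes "basic_data T A f" and "range g \<subseteq> A"
  shows "down T g m \<in> vertices T A f \<longleftrightarrow>
    g (corner1 T + m) = f (\<lambda>t\<in>tile_P T. g (t + m)) (g (corner2 T + m))"
proof -
  have tile: "tile T"
    using assms(1) by (auto simp: basic_data_def nondegenerate_tile_def)
  have "restrict (down T g m) (tile_P T) = (\<lambda>t\<in>tile_P T. g (t + m))"
    by (rule ext) (auto simp: down_def tile_P_def)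
  moreover have "down T g m \<in> T \<rightarrow>\<^sub>E A"
    using assms(2) by (auto simp: down_def)
  ultimately show ?thesis
    using corner1_in_tile[OF tile] corner2_in_tile[OF tile]
    by (simp add: vertices_iff[OF assms(1)] down_def)
qed

text \<open>
  At \<open>c\<^sub>1e\<^sub>1\<close> the new label is a value of \<open>f\<^sub>p\<close>; at \<open>c\<^sub>2e\<^sub>2\<close> it is a preimage under \<open>f\<^sub>p\<close>, which exists
  by surjectivity.  In both cases \<open>p\<close> itself does not change, since \<open>P\<close> excludes the two corners.
\<close>

lemma relabel_corner_to_vertex:
  assumes BD: "basic_data T A f" and g: "range g \<subseteq> A" and c: "c = corner1 T \<or> c = corner2 T"
  shows "\<exists>a\<in>A. down T (g(c + m := a)) m \<in> vertices T A f"
proof -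
  let ?p = "\<lambda>t\<in>tile_P T. g (t + m)"
  have "?p \<in> tile_P T \<rightarrow>\<^sub>E A"
    using g by auto
  then have "bij_betw (f ?p) A A"
    using BD by (auto simp: basic_data_def)
  then have image: "f ?p ` A = A"
    by (rule bij_betw_imp_surj_on)
  have distinct: "corner1 T \<noteq> corner2 T"
    using BD by (intro corners_distinct) (simp add: basic_data_def)
  have p: "(\<lambda>t\<in>tile_P T. (g(c + m := a)) (t + m)) = ?p" for a
    using c by (intro restrict_ext) (auto simp: tile_P_def)
  have iff: "down T (g(c + m := a)) m \<in> vertices T A f \<longleftrightarrow>
      (g(c + m := a)) (corner1 T + m) = f ?p ((g(c + m := a)) (corner2 T + m))" if "a \<in> A" for a
  proof -
    have "range (g(c + m := a)) \<subseteq> A"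
      using g that by auto
    from down_in_vertices_iff[OF BD this, of m] show ?thesis unfolding p .
  qed
  from c show ?thesis
  proof
    assume c1: "c = corner1 T"
    have "f ?p (g (corner2 T + m)) \<in> A"
      using image g by blast
    with c1 distinct show ?thesis
      by (intro bexI[of _ "f ?p (g (corner2 T + m))"]) (subst iff, simp_all)
  next
    assume c2: "c = corner2 T"
    have "g (corner1 T + m) \<in> f ?p ` A"
      using image g by auto
    then obtain a where "a \<in> A" "g (corner1 T + m) = f ?p a" by blast
    with c2 distinct show ?thesis
      by (intro bexI[of _ a]) (subst iff, simp_all)
  qed
qed

section \<open>Outer corners\<close>

text \<open>
  The corner of \<open>T + m\<close> on the side of the diagonal on which \<open>m\<close> lies; on the diagonal itself either
  corner would serve.
\<close>

definition outer_corner :: "(nat \<times> nat) set \<Rightarrow> nat \<times> nat \<Rightarrow> nat \<times> nat" where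
  "outer_corner T m = (if snd m \<le> fst m then corner1 T else corner2 T) + m"

definition diagonal_distance :: "nat \<times> nat \<Rightarrow> nat" where
  "diagonal_distance m = (fst m - snd m) + (snd m - fst m)"

text \<open>
  Suppose \<open>c\<^sub>1e\<^sub>1 + (i', j')\<close> with \<open>j' \<le> i'\<close> lies in \<open>T + (i, j)\<close>.  As \<open>c\<^sub>1\<close> is the largest first
  coordinate in \<open>T\<close>, this forces \<open>i' \<le> i\<close> and \<open>j \<le> j'\<close>, so \<open>(i, j)\<close> is on the same side of the
  diagonal and, unless it equals \<open>(i', j')\<close>, farther away from it.  The other side is symmetric.
\<close>

lemma outer_corner_in_other_tile:
  assumes "tile T" and "m \<noteq> m'" and "outer_corner T m' \<in> (\<lambda>t. t + m) ` T"
  shows "diagonal_distance m' < diagonal_distance m"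
proof -
  obtain i j i' j' where m: "m = (i, j)" "m' = (i', j')"
    by (meson surj_pair)
  obtain x y where t: "(x, y) \<in> T" "outer_corner T m' = (x, y) + m"
    using assms(3) by auto
  have "x \<le> fst (corner1 T)" "y \<le> snd (corner2 T)"
    using fst_le_corner1[OF assms(1) t(1)] snd_le_corner2[OF assms(1) t(1)] by simp_all
  then show ?thesis
    using t(2) \<open>m \<noteq> m'\<close>
    by (auto simp: m outer_corner_def diagonal_distance_def corner1_def corner2_def split: if_splits)
qed

text \<open>
  Let \<open>m = (i, j)\<close> with \<open>j \<le> i\<close>.  If \<open>m \<noteq> 0\<close> then \<open>i > 0\<close>, so \<open>c\<^sub>1e\<^sub>1 + m\<close> has first coordinate
  larger than \<open>c\<^sub>1\<close>; if \<open>m \<noteq> (k, k)\<close> then \<open>j < k\<close>, so its second coordinate is too small for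
  \<open>T + (k, k)\<close>.
\<close>

lemma outer_corner_avoids_end_tiles:
  assumes "tile T" and "m \<le> (k, k)" and "m \<noteq> (0, 0)" and "m \<noteq> (k, k)"
  shows "outer_corner T m \<notin> T" and "outer_corner T m \<notin> (\<lambda>t. t + (k, k)) ` T"
proof -
  obtain i j where m: "m = (i, j)"
    by (meson surj_pair)
  show "outer_corner T m \<notin> T"
  proof
    assume "outer_corner T m \<in> T"
    from fst_le_corner1[OF assms(1) this] snd_le_corner2[OF assms(1) this] assms(3)
    show False
      by (auto simp: m outer_corner_def corner1_def corner2_def split: if_splits)
  qed
  show "outer_corner T m \<notin> (\<lambda>t. t + (k, k)) ` T"
    using assms(2,4)
    by (auto simp: m outer_corner_def corner1_def corner2_def less_eq_prod_def split: if_splits)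
qed

section \<open>Joining two vertices by a path\<close>

lemma tile_disjoint_translate:
  assumes "tile T" and "n \<notin> T"
  shows "T \<inter> (\<lambda>t. t + n) ` T = {}"
proof -
  have "n \<le> t + n" for t :: "nat \<times> nat"
    by (simp add: less_eq_prod_def)
  then show ?thesis
    using tile_downward[OF assms(1)] assms(2) by blast
qed

lemma restrict_translates_is_path:
  assumes "range g \<subseteq> A" and "\<And>m. m \<le> n \<Longrightarrow> down T g m \<in> vertices T A f"
  shows "restrict g (translates T n) \<in> paths T A f n"
    and "m \<le> n \<Longrightarrow> down T (restrict g (translates T n)) m = down T g m"
proof -
  have down: "down T (restrict g (translates T n)) m = down T g m" if "m \<le> n" for m
    unfolding down_def
    by (rule restrict_ext) (use that in \<open>auto simp: translates_def less_eq_prod_def\<close>)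
  then show "m \<le> n \<Longrightarrow> down T (restrict g (translates T n)) m = down T g m" .
  show "restrict g (translates T n) \<in> paths T A f n"
    using assms down by (auto simp: paths_def)
qed

lemma ex_path_between_vertices:
  assumes BD: "basic_data T A f" and k: "(k, k) \<notin> T"
    and u: "u \<in> vertices T A f" and v: "v \<in> vertices T A f"
  shows "\<exists>l \<in> paths T A f (k, k). path_range T l = v \<and> path_source T (k, k) l = u"
proof -
  have tile: "tile T"
    using BD by (simp add: basic_data_def nondegenerate_tile_def)
  have uv: "u \<in> T \<rightarrow>\<^sub>E A" "v \<in> T \<rightarrow>\<^sub>E A"
    using u v by (simp_all add: vertices_iff[OF BD])
  obtain b where "b \<in> A"
    using BD by (auto simp: basic_data_def)
  let ?end = "(\<lambda>t. t + (k, k)) ` T"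
  define g0 where "g0 x = (if x \<in> T then v x else if x \<in> ?end then u (x - (k, k)) else b)" for x
  define M where "M = {m. m \<le> (k, k) \<and> m \<noteq> (0, 0) \<and> m \<noteq> (k, k)}"
  have "range g0 \<subseteq> A"
    using uv \<open>b \<in> A\<close> by (auto simp: g0_def PiE_iff)
  have "finite M"
    by (rule finite_subset[of _ "{..k} \<times> {..k}"]) (auto simp: M_def less_eq_prod_def)
  then obtain g where g: "range g \<subseteq> A" "\<And>x. x \<notin> outer_corner T ` M \<Longrightarrow> g x = g0 x"
    "\<And>m. m \<in> M \<Longrightarrow> down T g m \<in> vertices T A f"
  proof (rule solve_ranked_constraints[where C = "\<lambda>m g. down T g m \<in> vertices T A f"
        and S = "\<lambda>m. (\<lambda>t. t + m) ` T" and d = "outer_corner T" and rank = diagonal_distance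
        and A = A and ?g0.0 = g0])
    show "down T h m \<in> vertices T A f"
      if "\<And>x. x \<in> (\<lambda>t. t + m) ` T \<Longrightarrow> g x = h x" and "down T g m \<in> vertices T A f" for m g h
    proof -
      have "down T h m = down T g m"
        unfolding down_def by (intro restrict_ext that(1)[symmetric] imageI)
      with that(2) show ?thesis by simp
    qed
    show "\<exists>a\<in>A. down T (g(outer_corner T m := a)) m \<in> vertices T A f" if "range g \<subseteq> A" for m g
      unfolding outer_corner_def using relabel_corner_to_vertex[OF BD that] by simp
  qed (use outer_corner_in_other_tile[OF tile] \<open>range g0 \<subseteq> A\<close> in auto)
  have avoid: "x \<notin> outer_corner T ` M" if "x \<in> T \<or> x \<in> ?end" for x
    using outer_corner_avoids_end_tiles[OF tile, of _ k] that unfolding M_def by blast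
  have "g t = v t" if "t \<in> T" for t
    using g(2)[of t] avoid that by (simp add: g0_def)
  then have down_0: "down T g 0 = v"
    unfolding down_def using PiE_restrict[OF uv(2)] by (simp cong: restrict_cong)
  have "g (t + (k, k)) = u t" if "t \<in> T" for t
  proof -
    have "t + (k, k) \<in> ?end" using that by blast
    moreover from this have "t + (k, k) \<notin> T"
      using tile_disjoint_translate[OF tile k] by blast
    moreover have "t + (k, k) - (k, k) = t"
      by (cases t) simp
    ultimately show ?thesis
      using g(2)[of "t + (k, k)"] avoid by (simp add: g0_def)
  qed
  then have down_k: "down T g (k, k) = u"
    unfolding down_def using PiE_restrict[OF uv(1)] by (simp cong: restrict_cong)
  have "down T g m \<in> vertices T A f" if "m \<le> (k, k)" for m
    using g(3)[of m] down_0 down_k u v that by (cases "m \<in> M") (auto simp: M_def zero_prod_def)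
  note path = restrict_translates_is_path[where n = "(k, k)", OF g(1) this]
  show ?thesis
  proof (intro bexI conjI)
    let ?l = "restrict g (translates T (k, k))"
    show "?l \<in> paths T A f (k, k)"
      by (rule path(1))
    show "path_range T ?l = v"
      using path(2)[of 0] down_0 by (simp add: path_range_def less_eq_prod_def)
    show "path_source T (k, k) ?l = u"
      using path(2)[of "(k, k)"] down_k by (simp add: path_source_def)
  qed
qed

theorem proposition3p20:
  fixes T :: "(nat \<times> nat) set" and A :: "'a set"
    and f :: "(nat \<times> nat \<Rightarrow> 'a) \<Rightarrow> 'a \<Rightarrow> 'a" and k :: nat
  assumes "basic_data T A f"
    and "k \<ge> 1" and "(k - 1, k - 1) \<in> T" and "(k, k) \<notin> T"
  shows "(\<forall>u \<in> vertices T A f. \<forall>v \<in> vertices T A f.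
            \<exists>l \<in> paths T A f (k, k). path_range T l = v \<and> path_source T (k, k) l = u)
         \<and> strongly_connected (Lambda_BD T A f)"
proof -
  have paths: "\<forall>u \<in> vertices T A f. \<forall>v \<in> vertices T A f.
      \<exists>l \<in> paths T A f (k, k). path_range T l = v \<and> path_source T (k, k) l = u"
    using ex_path_between_vertices[OF assms(1,4)] by blast
  moreover have "strongly_connected (Lambda_BD T A f)"
    unfolding strongly_connected_def
  proof (intro ballI)
    fix u v assume "u \<in> objs (Lambda_BD T A f)" "v \<in> objs (Lambda_BD T A f)"
    then have "u \<in> vertices T A f" "v \<in> vertices T A f"
      by (simp_all add: Lambda_BD_def)
    with paths obtain l where
      "l \<in> paths T A f (k, k)" "path_range T l = v" "path_source T (k, k) l = u"
      by blast
    then show "\<exists>l\<in>mors (Lambda_BD T A f). rng (Lambda_BD T A f) l = v \<and> src (Lambda_BD T A f) l = u"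
      by (intro bexI[of _ "((k, k), l)"]) (simp_all add: Lambda_BD_def)
  qed
  ultimately show ?thesis by blast
qed

end
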